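(* Let $a\ge 0$. There exists some $c>0$ such that $$\frac1c\ \le\ \frac{f_a(m)}{\sqrt{1+a\,m^2}}\ \le\ c\qquad\text{for all }m>0 .$$
   Context: Let $n\ge2$, $d=n-1$, $p>d$, and let $\omega_d$ be the volume of the unit ball of $\mathbf R^d$. For $\hat r>0$, $\xi\ge0$ set $$q^d_\infty(\xi,\hat r)=\inf\Big\{\int_{\hat r}^{\infty}t^{d-1}\big[|v'|^p+(1-v)^2\big]dt:\ v\in W^{1,p}_{loc}((\hat r,\infty))\cap C([\hat r,\infty)),\ v(\hat r)=\xi,\ \lim_{t\to\infty}v(t)=1\Big\}.$$ $f_a:=f_a^d$ is defined by $f_a(0)=0$ and, for $m>0$, $$f_a(m)=\inf_{\hat r>0}\Big\{\frac{a\,m^2}{\omega_d\hat r^d}+\omega_d\hat r^d+d\,\omega_d\,q^d_\infty(0,\hat r)\Big\}$$ (a minimum when $a>0$). *)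

theory Defs
  imports "HOL-Analysis.Analysis"
begin

definition Lp_loc :: "real \<Rightarrow> real set \<Rightarrow> (real \<Rightarrow> real) \<Rightarrow> bool" where
  "Lp_loc p S f \<longleftrightarrow>
     f \<in> borel_measurable (lebesgue_on S) \<and>
     (\<forall>K. compact K \<and> K \<subseteq> S \<longrightarrow> integrable (lebesgue_on K) (\<lambda>t. \<bar>f t\<bar> powr p))"

definition test_function :: "real set \<Rightarrow> (real \<Rightarrow> real) \<Rightarrow> bool" where
  "test_function S \<phi> \<longleftrightarrow>
     (\<forall>k. (deriv ^^ k) \<phi> differentiable_on UNIV) \<and>
     compact (closure {t. \<phi> t \<noteq> 0}) \<and> closure {t. \<phi> t \<noteq> 0} \<subseteq> S"

definition has_weak_deriv :: "(real \<Rightarrow> real) \<Rightarrow> (real \<Rightarrow> real) \<Rightarrow> real set \<Rightarrow> bool" where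
  "has_weak_deriv v w S \<longleftrightarrow>
     (\<forall>\<phi>. test_function S \<phi> \<longrightarrow>
        (LINT t|lebesgue_on S. v t * deriv \<phi> t) = - (LINT t|lebesgue_on S. w t * \<phi> t))"

text \<open>The Sobolev space \<open>W\<^sup>1\<^sup>,\<^sup>p\<close>, local version on the open set \<open>S\<close>, as a relation
  between a function \<open>v\<close> and a representative \<open>w\<close> of its weak derivative. The
  weak derivative is unique only up to null sets, so the functions \<open>w\<close> below range over one
  equivalence class for each \<open>v\<close>.\<close>

definition W1p_loc :: "real \<Rightarrow> real set \<Rightarrow> (real \<Rightarrow> real) \<Rightarrow> (real \<Rightarrow> real) \<Rightarrow> bool" where
  "W1p_loc p S v w \<longleftrightarrow> Lp_loc p S v \<and> Lp_loc p S w \<and> has_weak_deriv v w S"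

definition admissible :: "real \<Rightarrow> real \<Rightarrow> real \<Rightarrow> ((real \<Rightarrow> real) \<times> (real \<Rightarrow> real)) set" where
  "admissible p \<xi> r =
     {(v, w). W1p_loc p {r<..} v w \<and> continuous_on {r..} v \<and> v r = \<xi> \<and> (v \<longlongrightarrow> 1) at_top}"

text \<open>Energies may be infinite for admissible functions, hence the values in \<^typ>\<open>ennreal\<close>.\<close>

definition q_inf :: "nat \<Rightarrow> real \<Rightarrow> real \<Rightarrow> real \<Rightarrow> ennreal" where
  "q_inf d p \<xi> r =
     (INF (v, w) \<in> admissible p \<xi> r.
        \<integral>\<^sup>+ t. ennreal (t ^ (d - 1) * (\<bar>w t\<bar> powr p + (1 - v t)\<^sup>2)) \<partial>lebesgue_on {r<..})"

definition f_a :: "nat \<Rightarrow> real \<Rightarrow> real \<Rightarrow> real \<Rightarrow> ennreal" where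
  "f_a d p a m =
     (if m = 0 then 0
      else INF r \<in> {0<..}.
        ennreal (a * m\<^sup>2 / (unit_ball_vol (real d) * r ^ d) + unit_ball_vol (real d) * r ^ d)
        + ennreal (real d * unit_ball_vol (real d)) * q_inf d p 0 r)"

end

theory Submission
  imports Defs
begin

text \<open>
  Write \<open>S = sqrt (1 + a m\<^sup>2)\<close> and let \<open>\<omega>\<close> be the volume of the unit ball. Choosing \<open>r\<close> with
  \<open>\<omega> r ^ d = S\<close> and a smooth profile rising from 0 to 1 on \<open>[r, r + 1]\<close>, whose energy is of order
  \<open>(1 + r) ^ d\<close>, gives the upper bound. For the lower bound, \<open>a m\<^sup>2 / (\<omega> r ^ d) + \<omega> r ^ d\<close> dominates
  \<open>sqrt a m\<close>, so a positive lower bound independent of \<open>r\<close> and \<open>m\<close> suffices. The term \<open>\<omega> r ^ d\<close>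
  provides it for \<open>r \<ge> 1\<close>. For \<open>r < 1\<close> a profile either stays below 1/2 on \<open>(1, 2)\<close> and pays for it
  in \<open>(1 - v)\<^sup>2\<close>, or it climbs to 1/2 before \<open>t = 2\<close>. In the latter case the integral of \<open>\<bar>v'\<bar>\<close> over
  \<open>(r, 2)\<close> is at least 1/4, and because \<open>p > d\<close> makes \<open>t powr (- (d - 1) / (p - 1))\<close> integrable at 0,
  this bounds the weighted \<open>p\<close>-energy from below: points have positive \<open>p\<close>-capacity.
\<close>

subsection \<open>A smooth step function\<close>

text \<open>The regularity clause of \<open>test_function\<close>, isolated. Since
  \<open>deriv\<close> is a total operator, asking every iterate to be differentiable is what makes
  all iterates genuine derivatives.\<close>

definition smooth :: "(real \<Rightarrow> real) \<Rightarrow> bool" where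
  "smooth f \<longleftrightarrow> (\<forall>k. (deriv ^^ k) f differentiable_on UNIV)"

text \<open>Smoothness as a greatest fixed point: a family closed under differentiation contains all
  iterated derivatives of its members. Later proofs only have to exhibit such a family and need no
  formula for the \<open>k\<close>-th derivative.\<close>

lemma smooth_coinduct:
  assumes "f \<in> F"
    and F: "\<And>g. g \<in> F \<Longrightarrow> \<exists>g'\<in>F. \<forall>x. (g has_field_derivative g' x) (at x)"
  shows "smooth f"
proof -
  have "(deriv ^^ k) f \<in> F" for k
  proof (induction k)
    case (Suc k)
    then obtain g' where "g' \<in> F" "\<forall>x. ((deriv ^^ k) f has_field_derivative g' x) (at x)"
      using F by blast
    then have "deriv ((deriv ^^ k) f) = g'" by (auto intro: DERIV_imp_deriv)
    with \<open>g' \<in> F\<close> show ?case by simp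
  qed (use \<open>f \<in> F\<close> in simp)
  moreover have "g differentiable_on UNIV" if "g \<in> F" for g
    using F[OF that] by (force simp: differentiable_on_def real_differentiable_def)
  ultimately show ?thesis by (simp add: smooth_def)
qed

lemma smooth_DERIV: "smooth f \<Longrightarrow> (f has_field_derivative deriv f x) (at x)"
  by (metis DERIV_deriv_iff_real_differentiable UNIV_I differentiable_on_def funpow_0 smooth_def)

lemma smooth_deriv: "smooth f \<Longrightarrow> smooth (deriv f)"
  unfolding smooth_def by (metis comp_apply funpow_Suc_right)

lemma smooth_antiderivative: "(\<And>x. (f has_field_derivative g x) (at x)) \<Longrightarrow> smooth g \<Longrightarrow> smooth f"
  by (rule smooth_coinduct[of f "insert f {g. smooth g}"]) (auto intro: smooth_DERIV smooth_deriv)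

lemma smooth_diff:
  assumes "smooth f" "smooth g" shows "smooth (\<lambda>x. f x - g x)"
proof (rule smooth_coinduct[of _ "{\<lambda>x. f x - g x |f g. smooth f \<and> smooth g}"], use assms in blast, safe)
  fix f g assume fg: "smooth f" "smooth g"
  then show "\<exists>g'\<in>{\<lambda>x. f x - g x |f g. smooth f \<and> smooth g}.
      \<forall>x. ((\<lambda>x. f x - g x) has_field_derivative g' x) (at x)"
    by (intro bexI[of _ "\<lambda>x. deriv f x - deriv g x"])
       (auto intro: smooth_deriv DERIV_diff smooth_DERIV)
qed

lemma smooth_affine:
  assumes "smooth f" shows "smooth (\<lambda>x. f (a * x + b))"
\<comment> \<open>The factor \<open>c\<close> absorbs the powers of \<open>a\<close> that the chain
  rule produces.\<close>
proof (rule smooth_coinduct[of _ "{\<lambda>x. c * f (a * x + b) |c f. smooth f}"], safe)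
  show "\<exists>c g. (\<lambda>x. f (a * x + b)) = (\<lambda>x. c * g (a * x + b)) \<and> smooth g"
    using assms by (intro exI[of _ 1] exI[of _ f]) simp
next
  fix c f assume f: "smooth f"
  have "((\<lambda>x. c * f (a * x + b)) has_field_derivative c * a * deriv f (a * x + b)) (at x)" for x
    by (auto intro!: derivative_eq_intros DERIV_chain'[OF _ smooth_DERIV[OF f]])
  with f smooth_deriv show "\<exists>g'\<in>{\<lambda>x. c * f (a * x + b) |c f. smooth f}.
      \<forall>x. ((\<lambda>x. c * f (a * x + b)) has_field_derivative g' x) (at x)"
    by (intro bexI[of _ "\<lambda>x. c * a * deriv f (a * x + b)"]) auto
qed

text \<open>By the Leibniz rule this set is closed under differentiation.\<close>

inductive_set sum_prods :: "(real \<Rightarrow> real) set" where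
  prod: "smooth f \<Longrightarrow> smooth g \<Longrightarrow> (\<lambda>x. f x * g x) \<in> sum_prods"
| sum: "F \<in> sum_prods \<Longrightarrow> G \<in> sum_prods \<Longrightarrow> (\<lambda>x. F x + G x) \<in> sum_prods"

lemma smooth_mult:
  assumes "smooth f" "smooth g" shows "smooth (\<lambda>x. f x * g x)"
proof (rule smooth_coinduct[of _ sum_prods])
  show "\<exists>g'\<in>sum_prods. \<forall>x. (h has_field_derivative g' x) (at x)" if "h \<in> sum_prods" for h
    using that
  proof induction
    case (prod f g)
    then show ?case
      by (intro bexI[of _ "\<lambda>x. deriv f x * g x + f x * deriv g x"])
         (auto intro!: sum_prods.intros smooth_deriv derivative_eq_intros smooth_DERIV)
  next
    case (sum F G)
    then obtain F' G' where
      "F' \<in> sum_prods" "\<forall>x. (F has_field_derivative F' x) (at x)"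
      "G' \<in> sum_prods" "\<forall>x. (G has_field_derivative G' x) (at x)" by blast
    then show ?case
      by (intro bexI[of _ "\<lambda>x. F' x + G' x"]) (auto intro!: sum_prods.intros derivative_eq_intros)
  qed
qed (use assms in \<open>auto intro: sum_prods.intros\<close>)

text \<open>Derivatives of \<open>exp (- 1 / x)\<close> stay in this family, which makes its members smooth at 0.\<close>

definition flat :: "real poly \<Rightarrow> real \<Rightarrow> real" where
  "flat P x = (if x > 0 then poly P (inverse x) * exp (- inverse x) else 0)"

lemma poly_times_exp_neg_tendsto_0:
  "((\<lambda>y. poly P y * exp (- y)) \<longlongrightarrow> (0::real)) at_top"
proof -
  \<comment> \<open>Splitting off the constant coefficient leaves an extra factor \<open>y\<close>
    on the remaining polynomial, so the induction carries an arbitrary power of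
    \<open>y\<close>.\<close>
  have "((\<lambda>y. y ^ k * poly P y * exp (- y)) \<longlongrightarrow> 0) at_top" for k
  proof (induction P arbitrary: k)
    case (pCons c P)
    have "((\<lambda>y. c * (y ^ k / exp y) + y ^ Suc k * poly P y * exp (- y)) \<longlongrightarrow> c * 0 + 0) at_top"
      by (intro tendsto_intros tendsto_power_div_exp_0 pCons.IH)
    then show ?case by (simp add: algebra_simps exp_minus divide_inverse)
  qed simp
  from this[of 0] show ?thesis by simp
qed

lemma flat_tendsto_0: "(flat P \<longlongrightarrow> 0) (at 0)"
proof -
  have "(flat P \<longlongrightarrow> 0) (at_right 0)"
  proof (rule Lim_transform_eventually)
    show "((\<lambda>x. poly P (inverse x) * exp (- inverse x)) \<longlongrightarrow> 0) (at_right 0)"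
      by (rule filterlim_compose[OF poly_times_exp_neg_tendsto_0 filterlim_inverse_at_top_right])
    show "\<forall>\<^sub>F x in at_right 0. poly P (inverse x) * exp (- inverse x) = flat P x"
      using eventually_at_right_less[of 0] by eventually_elim (simp add: flat_def)
  qed
  moreover have "(flat P \<longlongrightarrow> 0) (at_left 0)"
    by (rule tendsto_eventually) (auto simp: flat_def eventually_at_filter)
  ultimately show ?thesis by (simp add: filterlim_at_split)
qed

text \<open>With \<open>y = 1 / x\<close> one has \<open>y' = - y^2\<close>, so
  \<open>P(y) exp(-y)\<close> has derivative \<open>y^2 (P(y) - P'(y)) exp(-y)\<close>; the
  polynomial \<open>[:0, 0, 1:]\<close> is \<open>y^2\<close>.\<close>

lemma flat_DERIV: "(flat P has_field_derivative flat ([:0, 0, 1:] * (P - pderiv P)) x) (at x)"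
proof (cases x "0 :: real" rule: linorder_cases)
  case less
  have "((\<lambda>_. 0) has_field_derivative flat ([:0, 0, 1:] * (P - pderiv P)) x) (at x)"
    using less by (auto simp: flat_def)
  then show ?thesis
    by (rule has_field_derivative_transform_within_open[of _ _ _ "{..<0}"])
       (use less in \<open>auto simp: flat_def\<close>)
next
  case equal
  \<comment> \<open>Dividing by \<open>h\<close> multiplies the polynomial by \<open>y\<close>, so
    the difference quotient at 0 is again a member of the family and tends to 0.\<close>
  have "((\<lambda>h. (flat P (0 + h) - flat P 0) / h) \<longlongrightarrow> 0) (at 0)"
    by (rule Lim_transform_eventually[OF flat_tendsto_0[of "[:0, 1:] * P"]])
       (auto simp: flat_def field_simps)
  then show ?thesis using equal by (simp add: DERIV_def) (simp add: flat_def)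
next
  case greater
  have "((\<lambda>x. poly P (inverse x) * exp (- inverse x)) has_field_derivative
      flat ([:0, 0, 1:] * (P - pderiv P)) x) (at x)"
    using greater
    by (auto intro!: derivative_eq_intros DERIV_chain'[OF _ poly_DERIV]
        simp: flat_def algebra_simps power2_eq_square)
  then show ?thesis
    by (rule has_field_derivative_transform_within_open[of _ _ _ "{0<..}"])
       (use greater in \<open>auto simp: flat_def\<close>)
qed

lemma smooth_flat: "smooth (flat P)"
  by (rule smooth_coinduct[of _ "range flat"]) (use flat_DERIV in blast)+

text \<open>A bump that is positive exactly on the open unit interval is integrated, and the
  antiderivative is divided by the total mass \<open>G 1\<close>. The step serves twice: to build
  cut-off test functions and as a competitor profile.\<close>

lemma smooth_step_exists:
  obtains H :: "real \<Rightarrow> real"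
  where "smooth H" "\<And>x. deriv H x \<ge> 0" "\<And>x. x \<le> 0 \<or> x \<ge> 1 \<Longrightarrow> deriv H x = 0"
    "\<And>x. 0 \<le> H x" "\<And>x. H x \<le> 1" "\<And>x. x \<le> 0 \<Longrightarrow> H x = 0" "\<And>x. x \<ge> 1 \<Longrightarrow> H x = 1"
proof -
  define h where "h x = flat 1 x * flat 1 (-1 * x + 1)" for x
  have smooth_h: "smooth h"
    unfolding h_def by (intro smooth_mult smooth_flat smooth_affine)
  have h_pos: "h x > 0" if "0 < x" "x < 1" for x
    using that by (simp add: h_def flat_def)
  have h_nonneg: "h x \<ge> 0" for x
    by (simp add: h_def flat_def)
  have h_0: "h x = 0" if "x \<le> 0 \<or> x \<ge> 1" for x
    using that by (auto simp: h_def flat_def)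
  have cont_h: "isCont h x" for x
    using smooth_DERIV[OF smooth_h] by (rule DERIV_isCont)
  define G where "G x = (LBINT t=ereal 0..ereal x. h t)" for x :: real
  have G': "(G has_field_derivative h x) (at x)" for x
  proof -
    \<comment> \<open>The window contains the base point 0 and has \<open>x\<close> in its interior,
      so the derivative within it is the full derivative, for negative \<open>x\<close> as
      well.\<close>
    have "(G has_vector_derivative h x) (at x within {-\<bar>x\<bar>-1..\<bar>x\<bar>+1})"
      unfolding G_def
      by (rule interval_integral_FTC2) (auto intro!: continuous_at_imp_continuous_on cont_h)
    moreover have "at x within {-\<bar>x\<bar>-1..\<bar>x\<bar>+1} = at x"
      by (rule at_within_interior) auto
    ultimately show ?thesis
      by (simp add: has_real_derivative_iff_has_vector_derivative)
  qed
  have G_mono: "G x \<le> G y" if "x \<le> y" for x y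
    by (rule DERIV_nonneg_imp_nondecreasing[OF that]) (use G' h_nonneg in blast)
  have G_0: "G 0 = 0" by (simp add: G_def)
  have G_neg: "G x = 0" if "x \<le> 0" for x
  proof (cases "x = 0")
    case False
    with that have "x < 0" by simp
    have "G x = G 0"
      using DERIV_isconst_end[OF \<open>x < 0\<close>, of G] G' h_0 
      by (metis DERIV_isCont continuous_at_imp_continuous_on less_imp_le)
    then show ?thesis using G_0 by simp
  qed (simp add: G_0)
  have G_ge1: "G x = G 1" if "x \<ge> 1" for x
  proof (cases "x = 1")
    case False
    with that have "1 < x" by simp
    then show ?thesis
      using DERIV_isconst_end[OF \<open>1 < x\<close>, of G] G' h_0
      by (metis DERIV_isCont continuous_at_imp_continuous_on less_imp_le)
  qed simp
  have "G 0 < G 1"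
  proof (rule DERIV_pos_imp_increasing_open[of 0 1 G])
    show "\<exists>y. (G has_field_derivative y) (at x) \<and> 0 < y" if "0 < x" "x < 1" for x
      using G' h_pos that by blast
    show "continuous_on {0..1} G"
      using G' DERIV_isCont by (blast intro: continuous_at_imp_continuous_on)
  qed simp
  then have G1: "G 1 > 0" using G_0 by simp
  define H where "H x = G x * inverse (G 1)" for x
  have smooth_G: "smooth G" using smooth_antiderivative[OF G' smooth_h] .
  have smooth_const: "smooth (\<lambda>_. c)" for c
    by (rule smooth_coinduct[of _ "range (\<lambda>c _. c)"]) (auto intro!: exI[of _ 0])
  show thesis
  proof
    show "smooth H" unfolding H_def by (intro smooth_mult smooth_G smooth_const)
    have H': "deriv H x = h x * inverse (G 1)" for x
      unfolding H_def by (rule DERIV_imp_deriv) (auto intro!: derivative_eq_intros G')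
    show "deriv H x \<ge> 0" for x
      using h_nonneg G1 by (simp add: H')
    show "x \<le> 0 \<or> x \<ge> 1 \<Longrightarrow> deriv H x = 0" for x
      using h_0 by (simp add: H')
    show "0 \<le> H x" for x
      using G_mono[of 0 x] G_neg[of x] G_0 G1 by (cases "x \<le> 0") (auto simp: H_def)
    show "H x \<le> 1" for x
      using G_mono[of x 1] G_ge1[of x] G1 by (cases "x \<le> 1") (auto simp: H_def field_simps)
    show "x \<le> 0 \<Longrightarrow> H x = 0" for x by (simp add: H_def G_neg)
    show "x \<ge> 1 \<Longrightarrow> H x = 1" for x using G1 G_ge1[of x] by (simp add: H_def)
  qed
qed

subsection \<open>Weak derivatives\<close>

lemma test_function_iff:
  "test_function S \<phi> \<longleftrightarrow>
     smooth \<phi> \<and> compact (closure {t. \<phi> t \<noteq> 0}) \<and> closure {t. \<phi> t \<noteq> 0} \<subseteq> S"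
  by (simp add: test_function_def smooth_def)

text \<open>Turns the Bochner integrals of \<open>has_weak_deriv\<close> into integrals over a
  compact interval, where the fundamental theorem of calculus applies.\<close>

lemma integral_lebesgue_on_Icc:
  fixes f :: "real \<Rightarrow> real"
  assumes "continuous_on {a..b} f" "{a..b} \<subseteq> S" "S \<in> sets lebesgue"
    and "\<And>t. t \<in> S \<Longrightarrow> t \<notin> {a..b} \<Longrightarrow> f t = 0"
  shows "(LINT t|lebesgue_on S. f t) = integral {a..b} f"
proof -
  have "(LINT t|lebesgue_on S. f t) = (LINT t|lebesgue_on S. (if t \<in> {a..b} then f t else 0))"
    using assms(4) by (intro Bochner_Integration.integral_cong) auto
  also have "\<dots> = (LINT t|lebesgue_on {a..b}. f t)"
    using assms by (subst Lebesgue_Measure.integral_restrict_Int) (auto simp: Int_absorb2)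
  also have "\<dots> = integral {a..b} f"
    using assms(1) by (intro lebesgue_integral_eq_integral continuous_imp_integrable_real) auto
  finally show ?thesis .
qed

text \<open>The weak identity is tested with a plateau \<open>\<phi>\<close>, bounded by 1 and
  supported in \<open>(r, T)\<close>, that rises close to \<open>r\<close> and falls just after
  \<open>b\<close>. Then \<open>\<phi>'\<close> averages \<open>v\<close> near \<open>r\<close> with
  positive and near \<open>b\<close> with negative sign, so the identity bounds the increment of
  \<open>v\<close> directly, without an absolutely continuous representative. The gap between
  \<open>c\<close> and \<open>v b - v r\<close> pays for the averaging.\<close>

lemma weak_deriv_increment_le:
  assumes weak: "has_weak_deriv v w {r<..}" and cont: "continuous_on {r..} v"
    and "r < b" "b < T" and c: "c < v b - v r"
  shows "ennreal c \<le> (\<integral>\<^sup>+t. ennreal (indicator {r<..<T} t * \<bar>w t\<bar>) \<partial>lebesgue_on {r<..})"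
proof (cases "c > 0")
  case True
  obtain H where H: "smooth H" "\<And>x. deriv H x \<ge> 0" "\<And>x. x \<le> 0 \<or> x \<ge> 1 \<Longrightarrow> deriv H x = 0"
    "\<And>x. 0 \<le> H x" "\<And>x. H x \<le> 1" "\<And>x. x \<le> 0 \<Longrightarrow> H x = 0" "\<And>x. x \<ge> 1 \<Longrightarrow> H x = 1"
    using smooth_step_exists by blast
  \<comment> \<open>Each end costs an error of at most \<open>\<delta>\<close>, and
    \<open>v b - v r - 2 * \<delta> = c\<close>.\<close>
  define \<delta> where "\<delta> = (v b - v r - c) / 2"
  have "\<delta> > 0" using c by (simp add: \<delta>_def)
  have near: "\<exists>e>0. \<forall>t\<ge>r. \<bar>t - x\<bar> < e \<longrightarrow> \<bar>v t - v x\<bar> < \<delta>" if "x \<ge> r" for x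
    using cont that \<open>\<delta> > 0\<close> unfolding continuous_on_iff dist_real_def by (metis atLeast_iff)
  obtain e where "e > 0" and e: "\<And>t. t \<ge> r \<Longrightarrow> \<bar>t - r\<bar> < e \<Longrightarrow> \<bar>v t - v r\<bar> < \<delta>"
    using near[of r] by auto
  obtain e' where "e' > 0" and e': "\<And>t. t \<ge> r \<Longrightarrow> \<bar>t - b\<bar> < e' \<Longrightarrow> \<bar>v t - v b\<bar> < \<delta>"
    using near[of b] \<open>r < b\<close> by auto
  \<comment> \<open>The rise takes place on \<open>[r + e1, r + 2 * e1]\<close>, so a third keeps it
    within distance \<open>e\<close> of \<open>r\<close> and before \<open>b\<close>; the fall on
    \<open>[b, b + e2]\<close> needs only a half.\<close>
  define e1 e2 where "e1 = min e (b - r) / 3" and "e2 = min e' (T - b) / 2"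
  define a B where "a = r + e1" and "B = b + e2"
  have pos: "e1 > 0" "e2 > 0"
    using \<open>e > 0\<close> \<open>e' > 0\<close> \<open>r < b\<close> \<open>b < T\<close> by (auto simp: e1_def e2_def)
  have order: "r < a" "a + e1 < b" "b < B" "B < T" "a + e1 - r < e" "e2 < e'"
    using pos \<open>r < b\<close> \<open>b < T\<close> \<open>e > 0\<close> \<open>e' > 0\<close>
    by (auto simp: e1_def e2_def a_def B_def min_def field_simps)
  \<comment> \<open>\<open>A\<close> rises from 0 to 1 on \<open>[a, a + e1]\<close> and
    \<open>C\<close> on \<open>[b, B]\<close>. The arguments are written in the shape that
    \<open>smooth_affine\<close> expects.\<close>
  define A C where "A t = H (1 / e1 * t + - a / e1)" and "C t = H (1 / e2 * t + - b / e2)" for t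
  define A' C' where "A' t = deriv H ((t - a) / e1) / e1" and "C' t = deriv H ((t - b) / e2) / e2" for t
  have A_eq: "A t = H ((t - a) / e1)" and C_eq: "C t = H ((t - b) / e2)" for t
    by (simp_all add: A_def C_def diff_divide_distrib)
  have scaled: "((\<lambda>t. H ((t - s) / e)) has_field_derivative deriv H ((t - s) / e) / e) (at t)" if "e > 0" for e s t
  proof -
    have "((\<lambda>t. (t - s) / e) has_field_derivative 1 / e) (at t)"
      using that by (auto intro!: derivative_eq_intros)
    from DERIV_chain'[OF this smooth_DERIV[OF H(1)]] show ?thesis by simp
  qed
  have A_DERIV: "(A has_field_derivative A' t) (at t)"
    and C_DERIV: "(C has_field_derivative C' t) (at t)" for t
    unfolding A_eq[abs_def] C_eq[abs_def] A'_def C'_def using pos by (simp_all add: scaled)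
  define \<phi> where "\<phi> t = A t - C t" for t
  have \<phi>_DERIV: "(\<phi> has_field_derivative A' t - C' t) (at t)" for t
    unfolding \<phi>_def by (intro derivative_intros A_DERIV C_DERIV)
  then have deriv_\<phi>: "deriv \<phi> = (\<lambda>t. A' t - C' t)"
    by (auto intro: DERIV_imp_deriv)
  have smooth_\<phi>: "smooth \<phi>"
    unfolding \<phi>_def A_def C_def by (intro smooth_diff smooth_affine H)
  have \<phi>_0: "\<phi> t = 0" if "t \<notin> {a..B}" for t
    using that pos order H(6,7) by (auto simp: \<phi>_def A_eq C_eq B_def field_simps)
  have \<phi>_bound: "\<bar>\<phi> t\<bar> \<le> 1" for t
    using H(4)[of "(t - a) / e1"] H(5)[of "(t - a) / e1"] H(4)[of "(t - b) / e2"] H(5)[of "(t - b) / e2"]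
    by (auto simp: \<phi>_def A_eq C_eq)
  have supp: "closure {t. \<phi> t \<noteq> 0} \<subseteq> {a..B}"
    by (intro closure_minimal) (use \<phi>_0 in blast, simp)
  have "compact (closure {t. \<phi> t \<noteq> 0})"
    using compact_Icc supp by (metis closed_closure compact_Int_closed inf.absorb_iff2)
  moreover have "closure {t. \<phi> t \<noteq> 0} \<subseteq> {r<..}"
    using supp order by fastforce
  ultimately have "test_function {r<..} \<phi>"
    using smooth_\<phi> by (simp add: test_function_iff)
  from weak[unfolded has_weak_deriv_def, rule_format, OF this]
  have weak_\<phi>: "(LINT t|lebesgue_on {r<..}. v t * (A' t - C' t)) = - (LINT t|lebesgue_on {r<..}. w t * \<phi> t)"
    by (simp only: deriv_\<phi>)
  have cont_deriv: "continuous_on X (\<lambda>t. A' t - C' t)" for X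
    unfolding deriv_\<phi>[symmetric] using smooth_DERIV[OF smooth_deriv[OF smooth_\<phi>]]
    by (blast intro: continuous_at_imp_continuous_on DERIV_isCont)
  have cont_v\<phi>: "continuous_on {a..B} (\<lambda>t. v t * (A' t - C' t))"
    using order by (intro continuous_intros cont_deriv continuous_on_subset[OF cont]) auto
  have "(LINT t|lebesgue_on {r<..}. v t * (A' t - C' t)) = integral {a..B} (\<lambda>t. v t * (A' t - C' t))"
  proof (rule integral_lebesgue_on_Icc[OF cont_v\<phi>])
    show "v t * (A' t - C' t) = 0" if "t \<notin> {a..B}" for t
      using that pos order by (auto simp: A'_def C'_def H(3) B_def field_simps)
  qed (use order in auto)
  \<comment> \<open>Where \<open>A'\<close> is nonzero, \<open>v\<close> is at most
    \<open>v r + \<delta>\<close>; where \<open>C'\<close> is nonzero, \<open>v\<close> is at least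
    \<open>v b - \<delta>\<close>. Freezing these values leaves an integrand with an explicit
    antiderivative.\<close>
  also have "\<dots> \<le> ((v r + \<delta>) * A B - (v b - \<delta>) * C B) - ((v r + \<delta>) * A a - (v b - \<delta>) * C a)"
  proof (rule has_integral_le[OF integrable_integral])
    show "(\<lambda>t. v t * (A' t - C' t)) integrable_on {a..B}"
      by (rule integrable_continuous_real[OF cont_v\<phi>])
    show "((\<lambda>t. (v r + \<delta>) * A' t - (v b - \<delta>) * C' t) has_integral
      ((v r + \<delta>) * A B - (v b - \<delta>) * C B) - ((v r + \<delta>) * A a - (v b - \<delta>) * C a)) {a..B}"
    proof (rule fundamental_theorem_of_calculus)
      show "((\<lambda>t. (v r + \<delta>) * A t - (v b - \<delta>) * C t) has_vector_derivative
          (v r + \<delta>) * A' t - (v b - \<delta>) * C' t) (at t within {a..B})" for t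
        unfolding has_real_derivative_iff_has_vector_derivative[symmetric]
        by (rule DERIV_subset[of _ _ _ UNIV])
           (auto intro!: derivative_eq_intros A_DERIV C_DERIV)
    qed (use order pos in auto)
    show "v t * (A' t - C' t) \<le> (v r + \<delta>) * A' t - (v b - \<delta>) * C' t" if "t \<in> {a..B}" for t
    proof -
      have "v t * A' t \<le> (v r + \<delta>) * A' t"
      proof (cases "t < a + e1")
        case True
        then have "v t \<le> v r + \<delta>"
          using e[of t] that order by (auto simp: abs_if split: if_splits)
        then show ?thesis using H(2) pos by (intro mult_right_mono) (auto simp: A'_def)
      next
        case False
        then have "A' t = 0" using H(3)[of "(t - a) / e1"] pos by (simp add: A'_def field_simps)
        then show ?thesis by simp
      qed
      moreover have "(v b - \<delta>) * C' t \<le> v t * C' t"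
      proof (cases "t > b")
        case True
        then have "v t \<ge> v b - \<delta>"
          using e'[of t] that order by (auto simp: B_def abs_if split: if_splits)
        then show ?thesis using H(2) pos by (intro mult_right_mono) (auto simp: C'_def)
      next
        case False
        then have "C' t = 0" using H(3)[of "(t - b) / e2"] pos by (simp add: C'_def field_simps)
        then show ?thesis by simp
      qed
      ultimately show ?thesis by (simp add: right_diff_distrib)
    qed
  qed
  also have "\<dots> = - c"
    using order pos H(6)[of "(a - a) / e1"] H(6)[of "(a - b) / e2"] H(7)[of "(B - a) / e1"] H(7)[of "(B - b) / e2"]
    by (simp add: A_eq C_eq B_def \<delta>_def field_simps)
  finally have c_le: "c \<le> (LINT t|lebesgue_on {r<..}. w t * \<phi> t)"
    using weak_\<phi> by simp
  \<comment> \<open>A non-integrable function has Bochner integral 0 by convention, but this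
    integral is at least \<open>c > 0\<close>.\<close>
  with True have int: "integrable (lebesgue_on {r<..}) (\<lambda>t. w t * \<phi> t)"
    using not_integrable_integral_eq by fastforce
  have "ennreal c \<le> ennreal (norm (LINT t|lebesgue_on {r<..}. w t * \<phi> t))"
    using c_le by (intro ennreal_leI) simp
  also have "\<dots> \<le> (\<integral>\<^sup>+t. ennreal (norm (w t * \<phi> t)) \<partial>lebesgue_on {r<..})"
    by (rule integral_norm_bound_ennreal[OF int])
  also have "\<dots> \<le> (\<integral>\<^sup>+t. ennreal (indicator {r<..<T} t * \<bar>w t\<bar>) \<partial>lebesgue_on {r<..})"
  proof (intro nn_integral_mono ennreal_leI)
    show "norm (w t * \<phi> t) \<le> indicator {r<..<T} t * \<bar>w t\<bar>" for t
      using \<phi>_0[of t] \<phi>_bound[of t] order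
      by (auto simp: indicator_def abs_mult mult_left_le)
  qed
  finally show ?thesis .
qed (simp add: ennreal_neg)

text \<open>Integration by parts over an interval whose interior contains the support of the test
  function, so that the boundary terms vanish.\<close>

lemma has_weak_derivI:
  assumes deriv: "\<And>t. (v has_field_derivative w t) (at t)" and cont: "continuous_on UNIV w"
  shows "has_weak_deriv v w {r<..}"
  unfolding has_weak_deriv_def
proof (intro allI impI)
  fix \<phi> assume "test_function {r<..} \<phi>"
  then have \<phi>: "smooth \<phi>" and K: "compact (closure {t. \<phi> t \<noteq> 0})" "closure {t. \<phi> t \<noteq> 0} \<subseteq> {r<..}"
    by (auto simp: test_function_iff)
  \<comment> \<open>An empty support has no extreme points and is treated separately; otherwise
    \<open>a\<close> is the midpoint between \<open>r\<close> and the leftmost point of the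
    support.\<close>
  obtain a b where ab: "r < a" "a < b" "closure {t. \<phi> t \<noteq> 0} \<subseteq> {a<..<b}"
  proof (cases "closure {t. \<phi> t \<noteq> 0} = {}")
    case True
    then show ?thesis by (intro that[of "r + 1" "r + 2"]) auto
  next
    case False
    obtain x where x: "x \<in> closure {t. \<phi> t \<noteq> 0}" "\<And>t. t \<in> closure {t. \<phi> t \<noteq> 0} \<Longrightarrow> x \<le> t"
      using compact_attains_inf[OF K(1) False] by blast
    obtain y where y: "y \<in> closure {t. \<phi> t \<noteq> 0}" "\<And>t. t \<in> closure {t. \<phi> t \<noteq> 0} \<Longrightarrow> t \<le> y"
      using compact_attains_sup[OF K(1) False] by blast
    have "r < x" using x(1) K(2) by blast
    show ?thesis
    proof (rule that[of "(r + x) / 2" "y + 1"])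
      show "closure {t. \<phi> t \<noteq> 0} \<subseteq> {(r + x) / 2<..<y + 1}"
        using x(2) y(2) \<open>r < x\<close> by fastforce
    qed (use \<open>r < x\<close> x(2)[OF y(1)] in auto)
  qed
  have \<phi>_0: "\<phi> t = 0" if "t \<notin> {a<..<b}" for t
    using that ab(3) closure_subset[of "{t. \<phi> t \<noteq> 0}"] by blast
  have \<phi>'_0: "deriv \<phi> t = 0" if "t \<notin> {a..b}" for t
  proof -
    have "(\<phi> has_field_derivative 0) (at t)"
      by (rule has_field_derivative_transform_within_open[of "\<lambda>_. 0" _ _ "- {a..b}"])
         (use that \<phi>_0 in auto)
    then show ?thesis by (rule DERIV_imp_deriv)
  qed
  have cont': "continuous_on X v" "continuous_on X w" "continuous_on X \<phi>" "continuous_on X (deriv \<phi>)" for X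
    using deriv smooth_DERIV[OF \<phi>] smooth_DERIV[OF smooth_deriv[OF \<phi>]] continuous_on_subset[OF cont]
    by (blast intro: continuous_at_imp_continuous_on DERIV_isCont)+
  have "((\<lambda>t. v t * deriv \<phi> t + w t * \<phi> t) has_integral v b * \<phi> b - v a * \<phi> a) {a..b}"
  proof (rule fundamental_theorem_of_calculus)
    have "((\<lambda>t. v t * \<phi> t) has_field_derivative v t * deriv \<phi> t + w t * \<phi> t) (at t)" for t
      by (auto intro!: derivative_eq_intros deriv smooth_DERIV[OF \<phi>])
    then show "((\<lambda>t. v t * \<phi> t) has_vector_derivative v t * deriv \<phi> t + w t * \<phi> t) (at t within {a..b})" for t
      unfolding has_real_derivative_iff_has_vector_derivative by (rule has_vector_derivative_at_within)
  qed (use ab in auto)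
  then have "integral {a..b} (\<lambda>t. v t * deriv \<phi> t + w t * \<phi> t) = 0"
    using \<phi>_0[of a] \<phi>_0[of b] by (simp add: integral_unique)
  moreover have "integral {a..b} (\<lambda>t. v t * deriv \<phi> t + w t * \<phi> t) =
      integral {a..b} (\<lambda>t. v t * deriv \<phi> t) + integral {a..b} (\<lambda>t. w t * \<phi> t)"
    by (intro Henstock_Kurzweil_Integration.integral_add integrable_continuous_real continuous_intros cont')
  moreover have "(LINT t|lebesgue_on {r<..}. v t * deriv \<phi> t) = integral {a..b} (\<lambda>t. v t * deriv \<phi> t)"
    by (rule integral_lebesgue_on_Icc) (use ab \<phi>'_0 in \<open>auto intro!: continuous_intros cont'\<close>)
  moreover have "(LINT t|lebesgue_on {r<..}. w t * \<phi> t) = integral {a..b} (\<lambda>t. w t * \<phi> t)"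
    by (rule integral_lebesgue_on_Icc) (use ab \<phi>_0 in \<open>auto intro!: continuous_intros cont'\<close>)
  ultimately show "(LINT t|lebesgue_on {r<..}. v t * deriv \<phi> t) = - (LINT t|lebesgue_on {r<..}. w t * \<phi> t)"
    by linarith
qed

lemma Lp_loc_continuous:
  assumes cont: "continuous_on UNIV f" and "p > 0" and S: "S \<in> sets lebesgue"
  shows "Lp_loc p S f"
  unfolding Lp_loc_def
proof (intro conjI allI impI)
  show "f \<in> borel_measurable (lebesgue_on S)"
    by (intro continuous_imp_measurable_on_sets_lebesgue S continuous_on_subset[OF cont]) simp
next
  fix K :: "real set" assume K: "compact K \<and> K \<subseteq> S"
  have "set_integrable lborel K (\<lambda>t. \<bar>f t\<bar> powr p)"
    using K \<open>p > 0\<close>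
    by (intro borel_integrable_compact[unfolded set_integrable_def[symmetric]]
        continuous_on_powr' continuous_intros continuous_on_subset[OF cont]) auto
  then show "integrable (lebesgue_on K) (\<lambda>t. \<bar>f t\<bar> powr p)"
    using K by (simp add: set_integrable_def integrable_restrict_space integrable_completion
        lmeasurable_compact fmeasurableD)
qed

subsection \<open>Bounds for the profile energy\<close>

text \<open>The competitor is the step translated to start at \<open>r\<close>. Its energy density
  vanishes beyond \<open>r + 1\<close>; before that, \<open>C\<close> bounds the bracket and
  \<open>(1 + r) ^ d\<close> the weight. Translation does not change the bound \<open>M\<close> on
  the slope, so \<open>C\<close> is independent of \<open>r\<close>.\<close>

lemma q_inf_upper_bound:
  assumes "d \<ge> 1" "p > 0"
  obtains C where "C > 0" "\<And>r. r > 0 \<Longrightarrow> q_inf d p 0 r \<le> ennreal (C * (1 + r) ^ d)"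
proof -
  obtain H where H: "smooth H" "\<And>x. deriv H x \<ge> 0" "\<And>x. x \<le> 0 \<or> x \<ge> 1 \<Longrightarrow> deriv H x = 0"
    "\<And>x. 0 \<le> H x" "\<And>x. H x \<le> 1" "\<And>x. x \<le> 0 \<Longrightarrow> H x = 0" "\<And>x. x \<ge> 1 \<Longrightarrow> H x = 1"
    using smooth_step_exists by blast
  have cont: "continuous_on UNIV H" "continuous_on UNIV (deriv H)"
    using smooth_DERIV[OF H(1)] smooth_DERIV[OF smooth_deriv[OF H(1)]]
    by (blast intro: continuous_at_imp_continuous_on DERIV_isCont)+
  have "bounded (deriv H ` {0..1})"
    by (intro compact_imp_bounded compact_continuous_image continuous_on_subset[OF cont(2)]) auto
  then obtain M where M: "\<And>x. x \<in> {0..1} \<Longrightarrow> \<bar>deriv H x\<bar> \<le> M"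
    unfolding bounded_iff real_norm_def by blast
  define C where "C = M powr p + 1"
  show thesis
  proof
    show "C > 0" by (simp add: C_def add_nonneg_pos)
    fix r :: real assume "r > 0"
    define v w where "v t = H (t - r)" and "w t = deriv H (t - r)" for t
    have cont_vw: "continuous_on UNIV v" "continuous_on UNIV w"
      unfolding v_def w_def by (intro continuous_intros continuous_on_compose2[OF cont(1)] continuous_on_compose2[OF cont(2)] subset_UNIV)+
    have "(v has_field_derivative w t) (at t)" for t
      unfolding v_def w_def using DERIV_shift[of H _ t "- r"] smooth_DERIV[OF H(1), of "t - r"] by simp
    then have "W1p_loc p {r<..} v w"
      using cont_vw \<open>p > 0\<close> by (simp add: W1p_loc_def Lp_loc_continuous has_weak_derivI)
    moreover have "(v \<longlongrightarrow> 1) at_top"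
      by (rule tendsto_eventually) (use H(7) in \<open>auto simp: v_def eventually_at_top_linorder intro!: exI[of _ "r + 1"]\<close>)
    ultimately have adm: "(v, w) \<in> admissible p 0 r"
      using cont_vw(1) H(6)[of 0] by (auto simp: admissible_def v_def intro: continuous_on_subset)
    have bound: "t ^ (d - 1) * (\<bar>w t\<bar> powr p + (1 - v t)\<^sup>2) \<le> C * (1 + r) ^ d * indicator {r..r + 1} t"
      if "t > r" for t
    proof (cases "t \<le> r + 1")
      case True
      have "t ^ (d - 1) \<le> (1 + r) ^ (d - 1)"
        using that True \<open>r > 0\<close> by (intro power_mono) auto
      also have "\<dots> \<le> (1 + r) ^ d"
        using \<open>r > 0\<close> by (intro power_increasing) auto
      finally have "t ^ (d - 1) \<le> (1 + r) ^ d" .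
      moreover have "\<bar>w t\<bar> powr p \<le> M powr p"
        using M[of "t - r"] that True \<open>p > 0\<close> by (intro powr_mono2) (auto simp: w_def)
      moreover have "(1 - v t)\<^sup>2 \<le> 1"
        using H(4,5)[of "t - r"] by (intro power_le_one) (auto simp: v_def)
      ultimately have "t ^ (d - 1) * (\<bar>w t\<bar> powr p + (1 - v t)\<^sup>2) \<le> (1 + r) ^ d * C"
        using \<open>r > 0\<close> by (intro mult_mono) (auto simp: C_def)
      then show ?thesis using True that by (simp add: mult.commute)
    next
      case False
      then show ?thesis using H(3)[of "t - r"] H(7)[of "t - r"] \<open>p > 0\<close> by (simp add: v_def w_def)
    qed
    have "q_inf d p 0 r \<le> (\<integral>\<^sup>+t. ennreal (t ^ (d - 1) * (\<bar>w t\<bar> powr p + (1 - v t)\<^sup>2)) \<partial>lebesgue_on {r<..})"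
      unfolding q_inf_def using adm by (intro INF_lower2[of "(v, w)"]) auto
    also have "\<dots> \<le> (\<integral>\<^sup>+t. ennreal (C * (1 + r) ^ d) * indicator {r..r + 1} t \<partial>lebesgue)"
    proof (subst nn_integral_restrict_space, simp, intro nn_integral_mono)
      show "ennreal (t ^ (d - 1) * (\<bar>w t\<bar> powr p + (1 - v t)\<^sup>2)) * indicator {r<..} t
          \<le> ennreal (C * (1 + r) ^ d) * indicator {r..r + 1} t" for t
        using bound[of t] by (auto simp: indicator_def ennreal_neg intro: ennreal_leI split: if_splits)
    qed
    also have "\<dots> = ennreal (C * (1 + r) ^ d)"
      by (subst nn_integral_cmult_indicator) auto
    finally show "q_inf d p 0 r \<le> ennreal (C * (1 + r) ^ d)" .
  qed
qed

text \<open>Integrated over \<open>t\<close>, this replaces Hoelder's inequality with weight \<open>t ^ k\<close>.\<close>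

lemma abs_le_weighted_powr:
  fixes x K t p :: real
  assumes "K > 0" "t > 0" "p > 1" "x \<ge> 0"
  shows "x \<le> K * t powr - (real k / (p - 1)) + K powr (1 - p) * (t ^ k * x powr p)"
proof (cases "x \<le> K * t powr - (real k / (p - 1))")
  case True
  then show ?thesis using assms by (simp add: add_increasing2)
next
  case False
  define y where "y = K * t powr - (real k / (p - 1))"
  have "y > 0" "x > y" using assms False by (auto simp: y_def)
  \<comment> \<open>As \<open>1 - p\<close> is negative, passing from \<open>x\<close> to the
    smaller \<open>y\<close> increases the second factor. The exponent of \<open>t\<close> in
    \<open>y\<close> is chosen so that \<open>y powr (1 - p)\<close> is a multiple of
    \<open>t ^ k\<close>.\<close>
  have "x = x powr p * x powr (1 - p)"
    using \<open>y > 0\<close> \<open>x > y\<close> by (simp add: powr_add[symmetric])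
  also have "\<dots> \<le> x powr p * y powr (1 - p)"
    using \<open>y > 0\<close> \<open>x > y\<close> \<open>p > 1\<close> by (intro mult_left_mono powr_mono2') auto
  also have "y powr (1 - p) = K powr (1 - p) * t ^ k"
  proof -
    have "- (real k / (p - 1)) * (1 - p) = real k"
      using \<open>p > 1\<close> by (simp add: field_simps)
    then show ?thesis
      using assms by (simp add: y_def powr_mult powr_powr powr_realpow)
  qed
  finally have "x \<le> K powr (1 - p) * (t ^ k * x powr p)" by (simp add: mult_ac)
  moreover have "0 \<le> K * t powr - (real k / (p - 1))" using assms by simp
  ultimately show ?thesis by linarith
qed

lemma q_inf_lower_bound:
  assumes "d \<ge> 1" "p > real d"
  obtains c where "c > 0" "\<And>r. 0 < r \<Longrightarrow> r < 1 \<Longrightarrow> ennreal c \<le> q_inf d p 0 r"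
proof -
  have "p > 1" using assms by linarith
  \<comment> \<open>\<open>p > d\<close> is exactly what makes \<open>\<alpha> < 1\<close>, hence
    \<open>t powr - \<alpha>\<close> integrable at 0.\<close>
  define \<alpha> where "\<alpha> = real (d - 1) / (p - 1)"
  have "\<alpha> < 1" using assms \<open>p > 1\<close> by (auto simp: \<alpha>_def of_nat_diff field_simps)
  \<comment> \<open>\<open>J\<close> is the integral of \<open>t powr - \<alpha>\<close> over
    \<open>[0, 2]\<close>. The choice of \<open>K\<close> gives \<open>K * J = 1 / 8\<close>, half
    of the increment 1/4 used below, so the other half must come from the energy.\<close>
  define J where "J = 2 powr (- \<alpha> + 1) / (- \<alpha> + 1)"
  have "J > 0" using \<open>\<alpha> < 1\<close> by (simp add: J_def)
  define K where "K = 1 / (8 * J)"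
  have "K > 0" using \<open>J > 0\<close> by (simp add: K_def)
  \<comment> \<open>The two entries are the energy bounds for a profile that stays below 1/2 on
    \<open>(1, 2)\<close> and for one that reaches 1/2 there.\<close>
  define c where "c = min (1 / 4) (K powr (p - 1) / 8)"
  show thesis
  proof
    show "c > 0" using \<open>K > 0\<close> by (simp add: c_def)
    fix r :: real assume r: "0 < r" "r < 1"
    have "ennreal c \<le> (\<integral>\<^sup>+t. ennreal (t ^ (d - 1) * (\<bar>w t\<bar> powr p + (1 - v t)\<^sup>2)) \<partial>lebesgue_on {r<..})"
      (is "_ \<le> ?E") if "(v, w) \<in> admissible p 0 r" for v w
    proof -
      from that have v: "continuous_on {r..} v" "v r = 0" and weak: "has_weak_deriv v w {r<..}"
        and w[measurable]: "w \<in> borel_measurable (lebesgue_on {r<..})"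
          "v \<in> borel_measurable (lebesgue_on {r<..})"
        by (auto simp: admissible_def W1p_loc_def Lp_loc_def)
      have [measurable]: "(\<lambda>t. t ^ (d - 1)) \<in> borel_measurable (lebesgue_on {r<..})"
        by (intro continuous_imp_measurable_on_sets_lebesgue continuous_intros) auto
      show ?thesis
      proof (cases "\<exists>b\<in>{1<..<2}. v b \<ge> 1 / 2")
        case False
        \<comment> \<open>On \<open>(1, 2)\<close> the weight is at least 1 and
          \<open>(1 - v t)\<^sup>2\<close> at least 1/4.\<close>
        have "ennreal (1 / 4) = (\<integral>\<^sup>+t. ennreal (1 / 4) * indicator {1<..<2::real} t \<partial>lebesgue)"
          by (subst nn_integral_cmult_indicator) auto
        also have "\<dots> \<le> ?E"
        proof (subst nn_integral_restrict_space, simp, intro nn_integral_mono)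
          fix t :: real
          have less: "v t < 1 / 2" if "1 < t" "t < 2"
            using False that by (simp add: not_le)
          have "1 / 4 \<le> t ^ (d - 1) * (\<bar>w t\<bar> powr p + (1 - v t)\<^sup>2)" if t: "1 < t" "t < 2"
          proof -
            have "(1 / 2)\<^sup>2 \<le> (1 - v t)\<^sup>2"
              using less t by (intro power_mono) auto
            then have "1 / 4 \<le> \<bar>w t\<bar> powr p + (1 - v t)\<^sup>2"
              by (simp add: power2_eq_square add_increasing)
            also have "\<dots> \<le> t ^ (d - 1) * (\<bar>w t\<bar> powr p + (1 - v t)\<^sup>2)"
              using t mult_right_mono[of 1 "t ^ (d - 1)" "\<bar>w t\<bar> powr p + (1 - v t)\<^sup>2"] by simp
            finally show ?thesis .
          qed
          then show "ennreal (1 / 4) * indicator {1<..<2} t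
              \<le> ennreal (t ^ (d - 1) * (\<bar>w t\<bar> powr p + (1 - v t)\<^sup>2)) * indicator {r<..} t"
            using r by (auto simp: indicator_def intro: ennreal_leI)
        qed
        finally show ?thesis
          by (rule order_trans[rotated]) (simp add: c_def ennreal_leI)
      next
        case True
        then obtain b where b: "1 < b" "b < 2" "v b \<ge> 1 / 2" by auto
        \<comment> \<open>The increment of \<open>v\<close> is at least 1/2; any constant strictly
          below it would serve.\<close>
        have "ennreal (1 / 4) \<le> (\<integral>\<^sup>+t. ennreal (indicator {r<..<2} t * \<bar>w t\<bar>) \<partial>lebesgue_on {r<..})"
          by (rule weak_deriv_increment_le[OF weak v(1), of b]) (use r b v(2) in auto)
        also have "\<dots> \<le> (\<integral>\<^sup>+t. ennreal K * ennreal (indicator {0..2} t * t powr - \<alpha>) +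
            ennreal (K powr (1 - p)) * ennreal (t ^ (d - 1) * (\<bar>w t\<bar> powr p + (1 - v t)\<^sup>2)) \<partial>lebesgue_on {r<..})"
        proof (rule nn_integral_mono)
          fix t assume "t \<in> space (lebesgue_on {r<..})"
          then have "t > r" by simp
          have le: "\<bar>w t\<bar> \<le> K * t powr - \<alpha> + K powr (1 - p) * (t ^ (d - 1) * \<bar>w t\<bar> powr p)"
            unfolding \<alpha>_def using \<open>K > 0\<close> \<open>p > 1\<close> \<open>t > r\<close> r by (intro abs_le_weighted_powr) auto
          have "indicator {r<..<2} t * \<bar>w t\<bar> \<le> K * (indicator {0..2} t * t powr - \<alpha>)
              + K powr (1 - p) * (t ^ (d - 1) * (\<bar>w t\<bar> powr p + (1 - v t)\<^sup>2))"
          proof (cases "t < 2")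
            case True
            have "K powr (1 - p) * (t ^ (d - 1) * \<bar>w t\<bar> powr p)
                \<le> K powr (1 - p) * (t ^ (d - 1) * (\<bar>w t\<bar> powr p + (1 - v t)\<^sup>2))"
              using \<open>t > r\<close> r by (intro mult_left_mono) auto
            with le show ?thesis using True \<open>t > r\<close> r by simp
          next
            case False
            then show ?thesis using \<open>K > 0\<close> \<open>t > r\<close> r by simp
          qed
          then show "ennreal (indicator {r<..<2} t * \<bar>w t\<bar>)
              \<le> ennreal K * ennreal (indicator {0..2} t * t powr - \<alpha>) + ennreal (K powr (1 - p)) *
                ennreal (t ^ (d - 1) * (\<bar>w t\<bar> powr p + (1 - v t)\<^sup>2))"
            using \<open>K > 0\<close> \<open>t > r\<close> r
            by (simp add: ennreal_mult[symmetric] ennreal_plus[symmetric] ennreal_leI del: ennreal_plus)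
        qed
        also have "\<dots> = ennreal K * (\<integral>\<^sup>+t. ennreal (indicator {0..2} t * t powr - \<alpha>) \<partial>lebesgue_on {r<..})
            + ennreal (K powr (1 - p)) * ?E"
        proof -
          have m1: "(\<lambda>t. ennreal (indicator {0..2} t * t powr - \<alpha>)) \<in> borel_measurable (lebesgue_on {r<..})"
            by (intro measurable_restrict_space1 measurable_completion) measurable
          have m2: "(\<lambda>t. ennreal (t ^ (d - 1) * (\<bar>w t\<bar> powr p + (1 - v t)\<^sup>2)))
              \<in> borel_measurable (lebesgue_on {r<..})"
            by measurable
          show ?thesis
            unfolding nn_integral_cmult[OF m1, symmetric] nn_integral_cmult[OF m2, symmetric]
            by (intro nn_integral_add borel_measurable_times_ennreal borel_measurable_const m1 m2)
        qed
        also have "\<dots> \<le> ennreal K * ennreal J + ennreal (K powr (1 - p)) * ?E"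
        proof (intro add_right_mono mult_left_mono)
          \<comment> \<open>Enlarging the domain from \<open>(r, 2)\<close> down to 0 makes the
            bound independent of \<open>r\<close>.\<close>
          have "(\<integral>\<^sup>+t. ennreal (indicator {0..2} t * t powr - \<alpha>) \<partial>lebesgue_on {r<..})
              \<le> (\<integral>\<^sup>+t. ennreal (indicator {0..2} t * t powr - \<alpha>) \<partial>lebesgue)"
            by (subst nn_integral_restrict_space) (auto intro!: nn_integral_mono simp: indicator_def)
          also have "\<dots> = (\<integral>\<^sup>+t. ennreal (indicator {0..2} t * t powr - \<alpha>) \<partial>lborel)"
            by (rule nn_integral_completion)
          also have "\<dots> = ennreal J"
            unfolding J_def
            by (rule nn_integral_has_integral_lebesgue) (use \<open>\<alpha> < 1\<close> has_integral_powr_from_0[of "- \<alpha>" 2] in auto)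
          finally show "(\<integral>\<^sup>+t. ennreal (indicator {0..2} t * t powr - \<alpha>) \<partial>lebesgue_on {r<..}) \<le> ennreal J" .
        qed simp
        finally have main: "ennreal (1 / 4) \<le> ennreal K * ennreal J + ennreal (K powr (1 - p)) * ?E" .
        show ?thesis
        proof (cases ?E)
          case (real e)
          have "1 / 4 \<le> K * J + K powr (1 - p) * e"
            using main real \<open>K > 0\<close> \<open>J > 0\<close>
            by (simp add: ennreal_mult[symmetric] ennreal_plus[symmetric] del: ennreal_plus)
          then have "1 / 8 \<le> K powr (1 - p) * e"
            using \<open>J > 0\<close> by (simp add: K_def)
          \<comment> \<open>This factor cancels \<open>K powr (1 - p)\<close> and isolates the
            energy.\<close>
          then have "K powr (p - 1) * (1 / 8) \<le> K powr (p - 1) * (K powr (1 - p) * e)"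
            by (rule mult_left_mono) simp
          also have "\<dots> = e"
            using \<open>K > 0\<close> by (simp add: mult.assoc[symmetric] powr_add[symmetric])
          finally show ?thesis using real by (simp add: c_def ennreal_leI min.coboundedI2)
        qed simp
      qed
    qed
    then show "ennreal c \<le> q_inf d p 0 r"
      unfolding q_inf_def by (intro INF_greatest) auto
  qed
qed

section \<open>The two-sided estimate for \<open>f_a\<close>\<close>

theorem mainTheorem8:
  fixes n d :: nat and p a :: real
  assumes "n \<ge> 2" and "d = n - 1" and "p > real d" and "a \<ge> 0"
  shows "\<exists>c::real. c > 0 \<and>
    (\<forall>m::real. m > 0 \<longrightarrow>
       ennreal (1 / c) \<le> f_a d p a m / ennreal (sqrt (1 + a * m\<^sup>2)) \<and>
       f_a d p a m / ennreal (sqrt (1 + a * m\<^sup>2)) \<le> ennreal c)"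
proof -
  have "d \<ge> 1" using assms by simp
  then have "p > 0" using assms by linarith
  define \<omega> where "\<omega> = unit_ball_vol (real d)"
  have "\<omega> > 0" by (simp add: \<omega>_def)
  define S where "S m = sqrt (1 + a * m\<^sup>2)" for m
  have S1: "S m \<ge> 1" for m using \<open>a \<ge> 0\<close> by (simp add: S_def)
  define X where "X m r = ennreal (a * m\<^sup>2 / (\<omega> * r ^ d) + \<omega> * r ^ d) + ennreal (real d * \<omega>) * q_inf d p 0 r" for m r
  have f_a_eq: "f_a d p a m = (INF r\<in>{0<..}. X m r)" if "m > 0" for m
    using that by (simp add: f_a_def X_def \<omega>_def)
  obtain c where c: "c > 0" "\<And>r. 0 < r \<Longrightarrow> r < 1 \<Longrightarrow> ennreal c \<le> q_inf d p 0 r"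
    using q_inf_lower_bound[OF \<open>d \<ge> 1\<close> \<open>p > real d\<close>] by blast
  obtain C where C: "C > 0" "\<And>r. r > 0 \<Longrightarrow> q_inf d p 0 r \<le> ennreal (C * (1 + r) ^ d)"
    using q_inf_upper_bound[OF \<open>d \<ge> 1\<close> \<open>p > 0\<close>] by blast

  \<comment> \<open>A lower bound for \<open>X m r\<close> uniform in \<open>m\<close> and
    \<open>r\<close>: the first entry covers \<open>r \<ge> 1\<close>, the second
    \<open>r < 1\<close>.\<close>
  define c0 where "c0 = min \<omega> (real d * \<omega> * c)"
  have "c0 > 0" using \<open>\<omega> > 0\<close> c \<open>d \<ge> 1\<close> by (simp add: c0_def)
  \<comment> \<open>With \<open>M = max c0 (sqrt a * m)\<close>, subadditivity of the square root
    gives \<open>S m \<le> 1 + sqrt a * m \<le> M / c0 + M = c1 * M\<close>.\<close>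
  define c1 where "c1 = 1 / c0 + 1"
  have "c1 > 0" using \<open>c0 > 0\<close> by (simp add: c1_def add_pos_pos)
  have lower: "ennreal (S m / c1) \<le> X m r" if "m > 0" "r > 0" for m r
  proof -
    have "\<omega> * r ^ d > 0" using \<open>\<omega> > 0\<close> \<open>r > 0\<close> by simp
    have "ennreal c0 \<le> X m r"
    proof (cases "r \<ge> 1")
      case True
      have "c0 \<le> \<omega>" by (simp add: c0_def)
      also have "\<dots> \<le> \<omega> * r ^ d" using True \<open>\<omega> > 0\<close> by simp
      also have "\<dots> \<le> a * m\<^sup>2 / (\<omega> * r ^ d) + \<omega> * r ^ d"
        using \<open>a \<ge> 0\<close> \<open>\<omega> * r ^ d > 0\<close> by simp
      finally show ?thesis unfolding X_def by (rule add_increasing2[OF zero_le ennreal_leI])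
    next
      case False
      have "ennreal c0 \<le> ennreal (real d * \<omega> * c)" by (intro ennreal_leI) (simp add: c0_def)
      also have "\<dots> = ennreal (real d * \<omega>) * ennreal c"
        using \<open>\<omega> > 0\<close> c by (simp add: ennreal_mult)
      also have "\<dots> \<le> ennreal (real d * \<omega>) * q_inf d p 0 r"
        using c(2)[of r] False \<open>r > 0\<close> by (intro mult_left_mono) auto
      finally show ?thesis unfolding X_def by (rule add_increasing[OF zero_le])
    qed
    moreover have "ennreal (sqrt a * m) \<le> X m r"
    proof -
      \<comment> \<open>This is \<open>x \<le> x\<^sup>2 / y + y\<close> with
        \<open>x = sqrt a * m\<close> and \<open>y = \<omega> * r ^ d\<close>: the larger of
        \<open>x\<close> and \<open>y\<close> decides which summand suffices.\<close>
      have "sqrt a * m \<le> a * m\<^sup>2 / (\<omega> * r ^ d) + \<omega> * r ^ d"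
      proof (cases "sqrt a * m \<le> \<omega> * r ^ d")
        case True
        then show ?thesis using \<open>a \<ge> 0\<close> \<open>\<omega> * r ^ d > 0\<close> by (simp add: add_increasing)
      next
        case False
        have "sqrt a * m * (\<omega> * r ^ d) \<le> sqrt a * m * (sqrt a * m)"
          using False \<open>m > 0\<close> \<open>a \<ge> 0\<close> by (intro mult_left_mono) auto
        also have "\<dots> = a * m\<^sup>2" using \<open>a \<ge> 0\<close> by (simp add: power2_eq_square mult_ac)
        finally have "sqrt a * m \<le> a * m\<^sup>2 / (\<omega> * r ^ d)"
          using \<open>\<omega> * r ^ d > 0\<close> by (simp add: pos_le_divide_eq)
        then show ?thesis using \<open>\<omega> * r ^ d > 0\<close> by linarith
      qed
      then show ?thesis unfolding X_def by (rule add_increasing2[OF zero_le ennreal_leI])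
    qed
    ultimately have "ennreal (max c0 (sqrt a * m)) \<le> X m r" by (simp add: max_def)
    moreover have "S m / c1 \<le> max c0 (sqrt a * m)"
    proof -
      have "S m \<le> 1 + sqrt a * m"
        using sqrt_add_le_add_sqrt[of 1 "a * m\<^sup>2"] \<open>a \<ge> 0\<close> \<open>m > 0\<close> by (simp add: S_def real_sqrt_mult)
      also have "\<dots> \<le> max c0 (sqrt a * m) / c0 + max c0 (sqrt a * m)"
        using \<open>c0 > 0\<close> by (intro add_mono) (auto simp: pos_le_divide_eq)
      also have "\<dots> = max c0 (sqrt a * m) * c1"
        by (simp add: c1_def algebra_simps)
      finally show ?thesis using \<open>c1 > 0\<close> by (simp add: pos_divide_le_eq)
    qed
    ultimately show ?thesis by (meson ennreal_leI order_trans)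
  qed

  \<comment> \<open>The 2 counts \<open>\<omega> * r ^ d = S m\<close> and
    \<open>a * m\<^sup>2 / S m \<le> S m\<close>. The rest bounds the profile energy through
    \<open>(1 + r) ^ d \<le> 2 ^ d * (1 + r ^ d)\<close>, where
    \<open>r ^ d = S m / \<omega>\<close> and \<open>1 \<le> S m\<close>.\<close>
  define c2 where "c2 = 2 + real d * \<omega> * C * 2 ^ d * (1 + 1 / \<omega>)"
  have "c2 > 0" using \<open>\<omega> > 0\<close> C by (simp add: c2_def add_pos_nonneg)
  have upper: "f_a d p a m \<le> ennreal (c2 * S m)" if "m > 0" for m
  proof -
    define r where "r = root d (S m / \<omega>)"
    have "S m > 0" using S1[of m] by linarith
    have "r > 0" using \<open>S m > 0\<close> \<open>\<omega> > 0\<close> \<open>d \<ge> 1\<close> by (simp add: r_def)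
    have rd: "r ^ d = S m / \<omega>"
      using \<open>S m > 0\<close> \<open>\<omega> > 0\<close> \<open>d \<ge> 1\<close> by (simp add: r_def)
    have "a * m\<^sup>2 \<le> (S m)\<^sup>2" using \<open>a \<ge> 0\<close> by (simp add: S_def)
    then have 1: "a * m\<^sup>2 / S m \<le> S m"
      using \<open>S m > 0\<close> by (simp add: pos_divide_le_eq power2_eq_square)
    have "(1 + r) ^ d \<le> 2 ^ d * (1 + r ^ d)"
    proof (cases "r \<le> 1")
      case True
      have "(1 + r) ^ d \<le> 2 ^ d * 1" using True \<open>r > 0\<close> by (simp add: power_mono)
      also have "\<dots> \<le> 2 ^ d * (1 + r ^ d)" using \<open>r > 0\<close> by (intro mult_left_mono) auto
      finally show ?thesis .
    next
      case False
      have "(1 + r) ^ d \<le> (2 * r) ^ d" using False by (intro power_mono) auto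
      also have "\<dots> \<le> 2 ^ d * (1 + r ^ d)" by (simp add: power_mult_distrib)
      finally show ?thesis .
    qed
    also have "\<dots> \<le> 2 ^ d * ((1 + 1 / \<omega>) * S m)"
      using S1[of m] by (simp add: rd distrib_right)
    finally have 2: "(1 + r) ^ d \<le> 2 ^ d * ((1 + 1 / \<omega>) * S m)" .
    have "f_a d p a m \<le> X m r"
      using \<open>r > 0\<close> by (simp add: f_a_eq[OF that] INF_lower)
    also have "\<dots> \<le> ennreal (a * m\<^sup>2 / S m + S m) + ennreal (real d * \<omega>) * ennreal (C * (1 + r) ^ d)"
      unfolding X_def using C(2)[OF \<open>r > 0\<close>] \<open>\<omega> > 0\<close> by (intro add_mono mult_left_mono) (auto simp: rd)
    also have "\<dots> = ennreal (a * m\<^sup>2 / S m + S m + real d * \<omega> * (C * (1 + r) ^ d))"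
      using \<open>\<omega> > 0\<close> \<open>S m > 0\<close> \<open>r > 0\<close> \<open>a \<ge> 0\<close> C(1)
      by (simp add: ennreal_mult[symmetric] ennreal_plus[symmetric] del: ennreal_plus)
    also have "\<dots> \<le> ennreal (c2 * S m)"
    proof (rule ennreal_leI)
      have "real d * \<omega> * (C * (1 + r) ^ d) \<le> real d * \<omega> * (C * (2 ^ d * ((1 + 1 / \<omega>) * S m)))"
        using \<open>\<omega> > 0\<close> C 2 by (intro mult_left_mono) auto
      with 1 have "a * m\<^sup>2 / S m + S m + real d * \<omega> * (C * (1 + r) ^ d) \<le>
          S m + S m + real d * \<omega> * (C * (2 ^ d * ((1 + 1 / \<omega>) * S m)))" by linarith
      also have "\<dots> = c2 * S m" by (simp add: c2_def algebra_simps)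
      finally show "a * m\<^sup>2 / S m + S m + real d * \<omega> * (C * (1 + r) ^ d) \<le> c2 * S m" .
    qed
    finally show ?thesis .
  qed

  show ?thesis
  \<comment> \<open>The lower bound holds for every \<open>r\<close>, hence for the infimum; the
    upper bound comes from a single \<open>r\<close>.\<close>
  proof (intro exI[of _ "max c1 c2"] conjI allI impI)
    show "max c1 c2 > 0" using \<open>c1 > 0\<close> by simp
    fix m :: real assume "m > 0"
    have "S m > 0" using S1[of m] by linarith
    have "ennreal (1 / max c1 c2) \<le> ennreal (S m / c1) / ennreal (S m)"
      using \<open>S m > 0\<close> \<open>c1 > 0\<close> by (simp add: divide_ennreal ennreal_leI frac_le)
    also have "\<dots> \<le> f_a d p a m / ennreal (S m)"
      unfolding f_a_eq[OF \<open>m > 0\<close>]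
      by (intro divide_right_mono_ennreal INF_greatest lower \<open>m > 0\<close>) simp
    finally show "ennreal (1 / max c1 c2) \<le> f_a d p a m / ennreal (sqrt (1 + a * m\<^sup>2))"
      by (simp add: S_def)
    have "f_a d p a m / ennreal (S m) \<le> ennreal (c2 * S m) / ennreal (S m)"
      by (intro divide_right_mono_ennreal upper \<open>m > 0\<close>)
    also have "\<dots> \<le> ennreal (max c1 c2)"
      using \<open>S m > 0\<close> \<open>c2 > 0\<close> by (simp add: divide_ennreal ennreal_leI)
    finally show "f_a d p a m / ennreal (sqrt (1 + a * m\<^sup>2)) \<le> ennreal (max c1 c2)"
      by (simp add: S_def)
  qed
qed

end
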